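(* Let $q\in\mathbb{C}$ with $0<|q|<1$, fix a value of $\ln q$, and for $l\in\mathbb{Z}$ let $c_l=-2\ln q\,\frac{q^{l}-q^{-l}}{q^l+q^{-l}}$. Let $t_n,h_n$ ($n\in 2\mathbb{Z}$) be abstract generators with Poisson brackets, for all $n,m\in 2\mathbb{Z}$, $$\{t_n,t_m\}=\sum_{l\in\mathbb{Z}}c_l\,t_{n-2l}t_{m+2l},\qquad \{h_n,t_m\}=-\sum_{l\in\mathbb{Z}}c_l\,h_{n-2l}t_{m+2l},\qquad \{h_n,h_m\}=\sum_{l\in\mathbb{Z}}c_l\,h_{n-2l}h_{m+2l}.$$ Put $s_n=q^{-\frac n2}t_n+q^{\frac n2}h_n$ for $n\in2\mathbb{Z}$. Then for all $n,m\in 2\mathbb{Z}$, $$\{s_n,s_m\}=-2\ln q\left[\sum_{l\in\mathbb{Z}}\frac{q^l-q^{-l}}{q^l+q^{-l}}\,s_{n-2l}\,s_{m+2l}+\left(q^{\frac{m-n}{2}}-q^{\frac{n-m}{2}}\right)\sum_{l\in\mathbb{Z}}h_{n+m-2l}\,t_{2l}\right],$$ and the last term is central: for all $r,n,m\in 2\mathbb{Z}$, $$\Big\{t_r,\sum_{l\in\mathbb{Z}}h_{n+m-2l}\,t_{2l}\Big\}=0,\qquad \Big\{h_r,\sum_{l\in\mathbb{Z}}h_{n+m-2l}\,t_{2l}\Big\}=0.$$ Consequently, for any function $\xi:2\mathbb{Z}\to\mathbb{C}$, after setting each central quantity $-2\ln q\sum_{l\in\mathbb{Z}}h_{N-2l}t_{2l}$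 equal to $\xi_N$ ($N\in 2\mathbb{Z}$), the $s_n$ satisfy $$\{s_n,s_m\}=-2\ln q\sum_{l\in\mathbb{Z}}\frac{q^l-q^{-l}}{q^l+q^{-l}}\,s_{n-2l}s_{m+2l}+\xi_{n+m}\left(q^{\frac{m-n}{2}}-q^{\frac{n-m}{2}}\right).$$
   Context: The $t_n,h_n$ are commuting variables, and brackets take values in formal, possibly infinite, linear combinations of commutative monomials in them. The bracket is bilinear, antisymmetric (so $\{t_m,h_n\}=-\{h_n,t_m\}$), and extended by the Leibniz rule termwise to formal infinite sums. In the brackets $\{t_r,\sum_l h_{N-2l}t_{2l}\}$ and $\{h_r,\sum_l h_{N-2l}t_{2l}\}$ the coefficient of each monomial is a finite sum. All identities are identities of formal sums, i.e. equality of the coefficients of all monomials. *)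

theory Defs
  imports Complex_Main "HOL-Library.Multiset" "HOL-Library.Groups_Big_Fun"
begin

section \<open>Formal infinite linear combinations of commutative monomials\<close>

text \<open>
  A monomial in the variables \<open>'v\<close> is a finite multiset of variables; a formal sum is an
  arbitrary family of complex coefficients indexed by the monomials.  Every monomial has only
  finitely many factorizations, so the product of two formal sums is always defined.
\<close>

typedef 'v formal = "UNIV :: ('v multiset \<Rightarrow> complex) set"
  morphisms coeff Formal ..

setup_lifting type_definition_formal

lemma formal_eqI: "(\<And>M. coeff F M = coeff G M) \<Longrightarrow> F = G"
  by (simp add: coeff_inject[symmetric] fun_eq_iff)

lemma coeff_Formal [simp]: "coeff (Formal f) = f"
  by (simp add: Formal_inverse)

lemma finite_submultisets: "finite {A. A \<subseteq># M}"
proof (induction M)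
  case (add x M)
  have "{A. A \<subseteq># add_mset x M} \<subseteq> {A. A \<subseteq># M} \<union> add_mset x ` {A. A \<subseteq># M}"
  proof
    fix A assume "A \<in> {A. A \<subseteq># add_mset x M}"
    hence A: "A \<subseteq># add_mset x M" by simp
    show "A \<in> {A. A \<subseteq># M} \<union> add_mset x ` {A. A \<subseteq># M}"
    proof (cases "x \<in># A")
      case True
      then obtain B where "A = add_mset x B" by (meson multi_member_split)
      thus ?thesis using A by auto
    next
      case False
      hence "A \<subseteq># M"
        using A by (metis diff_single_trivial subset_eq_diff_conv add_mset_add_single)
      thus ?thesis by simp
    qed
  qed
  thus ?case using add finite_subset by blast
qed simp

lemma finite_splits: "finite {(A, B). A + B = (M :: 'v multiset)}"
proof (rule finite_subset)
  show "{(A, B). A + B = M} \<subseteq> {A. A \<subseteq># M} \<times> {B. B \<subseteq># M}" by auto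
qed (simp add: finite_submultisets)

instantiation formal :: (type) comm_ring_1
begin

lift_definition zero_formal :: "'a formal" is "\<lambda>_. 0" .
lift_definition one_formal :: "'a formal" is "\<lambda>M. if M = {#} then 1 else 0" .
lift_definition plus_formal :: "'a formal \<Rightarrow> 'a formal \<Rightarrow> 'a formal" is "\<lambda>F G M. F M + G M" .
lift_definition minus_formal :: "'a formal \<Rightarrow> 'a formal \<Rightarrow> 'a formal" is "\<lambda>F G M. F M - G M" .
lift_definition uminus_formal :: "'a formal \<Rightarrow> 'a formal" is "\<lambda>F M. - F M" .
lift_definition times_formal :: "'a formal \<Rightarrow> 'a formal \<Rightarrow> 'a formal" is
  "\<lambda>F G M. \<Sum>(A, B) | A + B = M. F A * G B" .

lemma coeff_zero [simp]: "coeff 0 M = 0" by transfer simp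
lemma coeff_one: "coeff 1 M = (if M = {#} then 1 else 0)" by transfer simp
lemma coeff_plus [simp]: "coeff (F + G) M = coeff F M + coeff G M" by transfer simp
lemma coeff_minus [simp]: "coeff (F - G) M = coeff F M - coeff G M" by transfer simp
lemma coeff_uminus [simp]: "coeff (- F) M = - coeff F M" by transfer simp
lemma coeff_times: "coeff (F * G) M = (\<Sum>(A, B) | A + B = M. coeff F A * coeff G B)"
  by transfer simp

instance
proof
  fix a b c :: "'a formal"
  show "a * b * c = a * (b * c)"
  proof (rule formal_eqI)
    fix M
    have "coeff (a * b * c) M =
        (\<Sum>p | fst p + snd p = M. \<Sum>r | fst r + snd r = fst p.
            coeff a (fst r) * coeff b (snd r) * coeff c (snd p))"
      by (simp add: coeff_times case_prod_unfold sum_distrib_right)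
    also have "\<dots> = (\<Sum>(p, r) \<in> (SIGMA p:{p. fst p + snd p = M}. {r. fst r + snd r = fst p}).
            coeff a (fst r) * coeff b (snd r) * coeff c (snd p))"
      using finite_splits by (subst sum.Sigma) (auto simp: case_prod_unfold)
    also have "\<dots> = (\<Sum>(p, r) \<in> (SIGMA p:{p. fst p + snd p = M}. {r. fst r + snd r = snd p}).
            coeff a (fst p) * (coeff b (fst r) * coeff c (snd r)))"
      by (rule sum.reindex_bij_witness
           [where i = "\<lambda>(p, r). ((fst p + fst r, snd r), (fst p, fst r))" and
                  j = "\<lambda>(p, r). ((fst r, snd r + snd p), (snd r, snd p))"])
         (auto simp: add_ac mult_ac)
    also have "\<dots> = (\<Sum>p | fst p + snd p = M. \<Sum>r | fst r + snd r = snd p.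
            coeff a (fst p) * (coeff b (fst r) * coeff c (snd r)))"
      using finite_splits by (subst sum.Sigma) (auto simp: case_prod_unfold)
    also have "\<dots> = coeff (a * (b * c)) M"
      by (simp add: coeff_times case_prod_unfold sum_distrib_left)
    finally show "coeff (a * b * c) M = coeff (a * (b * c)) M" .
  qed
  show "a * b = b * a"
  proof (rule formal_eqI)
    fix M
    show "coeff (a * b) M = coeff (b * a) M"
      unfolding coeff_times
      by (rule sum.reindex_bij_witness[where i = prod.swap and j = prod.swap]) (auto simp: add_ac)
  qed
  show "1 * a = a"
  proof (rule formal_eqI)
    fix M
    have "coeff (1 * a) M = (\<Sum>(A, B) \<in> {({#}, M)}. coeff 1 A * coeff a B)"
      unfolding coeff_times using finite_splits
      by (intro sum.mono_neutral_right) (auto simp: coeff_one split: if_splits)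
    thus "coeff (1 * a) M = coeff a M" by (simp add: coeff_one)
  qed
  show "(a + b) * c = a * c + b * c"
    by (rule formal_eqI)
       (simp add: coeff_times case_prod_unfold distrib_right sum.distrib)
  show "(0 :: 'a formal) \<noteq> 1"
  proof
    assume "(0 :: 'a formal) = 1"
    hence "coeff (0 :: 'a formal) {#} = coeff 1 {#}" by simp
    thus False by (simp add: coeff_one)
  qed
qed (auto intro!: formal_eqI simp: add_ac)

end

lift_definition scale :: "complex \<Rightarrow> 'v formal \<Rightarrow> 'v formal" (infixr \<open>*\<^sub>f\<close> 75)
  is "\<lambda>a F M. a * F M" .

lemma coeff_scale [simp]: "coeff (a *\<^sub>f F) M = a * coeff F M" by transfer simp

global_interpretation formal: vector_space scale
  by unfold_locales (auto intro!: formal_eqI simp: algebra_simps)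

lift_definition monom :: "'v multiset \<Rightarrow> 'v formal" is "\<lambda>A M. if M = A then 1 else 0" .

lemma coeff_monom: "coeff (monom A) M = (if M = A then 1 else 0)" by transfer simp

abbreviation var :: "'v \<Rightarrow> 'v formal" where "var x \<equiv> monom {#x#}"

lemma monom_times_monom: "monom A * monom B = monom (A + B)"
proof (rule formal_eqI)
  fix M
  have "coeff (monom A * monom B) M = 
      (\<Sum>p | fst p + snd p = M. if p = (A, B) then 1 else 0)"
    unfolding coeff_times by (rule sum.cong) (auto simp: coeff_monom split: if_splits)
  also have "\<dots> = coeff (monom (A + B)) M"
    using finite_splits[of M] by (auto simp: coeff_monom case_prod_unfold)
  finally show "coeff (monom A * monom B) M = coeff (monom (A + B)) M" .
qed

lemma monom_empty: "monom {#} = 1"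
  by (rule formal_eqI) (simp add: coeff_monom coeff_one)

lemma coeff_monom_times_nz: "coeff (monom A * F) M \<noteq> 0 \<Longrightarrow> A \<subseteq># M"
  unfolding coeff_times
  by (drule sum.not_neutral_contains_not_neutral) (auto simp: coeff_monom split: if_splits)

text \<open>
  Infinite sums of formal sums are taken coefficientwise.  They are meaningful only for summable
  families: \<^const>\<open>Sum_any\<close> returns 0 for a family with infinite support.
\<close>

definition formal_summable :: "('i \<Rightarrow> 'v formal) \<Rightarrow> bool" where
  "formal_summable F \<longleftrightarrow> (\<forall>M. finite {i. coeff (F i) M \<noteq> 0})"

definition formal_sum :: "('i \<Rightarrow> 'v formal) \<Rightarrow> 'v formal" where
  "formal_sum F = Formal (\<lambda>M. Sum_any (\<lambda>i. coeff (F i) M))"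


section \<open>Extending a bracket of variables to formal sums\<close>

text \<open>
  Leibniz rule for two monomials; a variable of multiplicity \<open>k\<close> contributes \<open>k\<close> times.
\<close>

definition monom_bracket ::
    "('v \<Rightarrow> 'v \<Rightarrow> 'v formal) \<Rightarrow> 'v multiset \<Rightarrow> 'v multiset \<Rightarrow> 'v formal" where
  "monom_bracket \<beta> A B =
     (\<Sum>x\<in>#A. \<Sum>y\<in>#B. monom (A - {#x#}) * monom (B - {#y#}) * \<beta> x y)"

text \<open>Termwise bilinear extension, meaningful only if each coefficient is a finite sum.\<close>

definition bracket_defined ::
    "('v \<Rightarrow> 'v \<Rightarrow> 'v formal) \<Rightarrow> 'v formal \<Rightarrow> 'v formal \<Rightarrow> bool" where
  "bracket_defined \<beta> F G \<longleftrightarrow>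
     formal_summable (\<lambda>(A, B). (coeff F A * coeff G B) *\<^sub>f monom_bracket \<beta> A B)"

definition bracket ::
    "('v \<Rightarrow> 'v \<Rightarrow> 'v formal) \<Rightarrow> 'v formal \<Rightarrow> 'v formal \<Rightarrow> 'v formal" where
  "bracket \<beta> F G =
     formal_sum (\<lambda>(A, B). (coeff F A * coeff G B) *\<^sub>f monom_bracket \<beta> A B)"

lemma monom_bracket_var: "monom_bracket \<beta> {#x#} {#y#} = \<beta> x y"
  by (simp add: monom_bracket_def monom_empty)

lemma bracket_defined_finite_support:
  assumes "finite {A. coeff F A \<noteq> 0}" "finite {B. coeff G B \<noteq> 0}"
  shows "bracket_defined \<beta> F G"
  unfolding bracket_defined_def formal_summable_def
proof
  fix M
  show "finite {i. coeff (case i of (A, B) \<Rightarrow> (coeff F A * coeff G B) *\<^sub>f monom_bracket \<beta> A B) M \<noteq> 0}"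
    by (rule finite_subset[OF _ finite_cartesian_product[OF assms]]) auto
qed

lemma bracket_var: "bracket \<beta> (var x) (var y) = \<beta> x y"
proof (rule formal_eqI)
  fix M
  let ?f = "\<lambda>p. coeff (case p of (A, B) \<Rightarrow>
              (coeff (var x) A * coeff (var y) B) *\<^sub>f monom_bracket \<beta> A B) M"
  have "Sum_any ?f = sum ?f {({#x#}, {#y#})}"
    by (rule Sum_any.expand_superset) (auto simp: coeff_monom split: if_splits)
  thus "coeff (bracket \<beta> (var x) (var y)) M = coeff (\<beta> x y) M"
    by (simp add: bracket_def formal_sum_def coeff_monom monom_bracket_var)
qed

lemma bracket_antisym:
  assumes "\<And>x y. \<beta> x y = - \<beta> y x"
  shows "bracket \<beta> F G = - bracket \<beta> G F"
proof (rule formal_eqI)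
  fix M
  have neg_sum: "(\<Sum>x\<in>#A. - f x) = - (\<Sum>x\<in>#A. f x)" for A and f :: "'a \<Rightarrow> 'a formal"
    by (induction A) auto
  have mb: "monom_bracket \<beta> A B = - monom_bracket \<beta> B A" for A B
  proof -
    have "monom_bracket \<beta> A B =
        (\<Sum>y\<in>#B. \<Sum>x\<in>#A. monom (A - {#x#}) * monom (B - {#y#}) * \<beta> x y)"
      unfolding monom_bracket_def by (rule sum_mset.swap)
    also have "\<dots> = (\<Sum>y\<in>#B. \<Sum>x\<in>#A. - (monom (B - {#y#}) * monom (A - {#x#}) * \<beta> y x))"
      by (subst assms) (simp add: mult_ac)
    also have "\<dots> = - monom_bracket \<beta> B A"
      unfolding monom_bracket_def by (simp only: neg_sum)
    finally show ?thesis .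
  qed
  let ?f = "\<lambda>F G (A, B). coeff F A * coeff G B * coeff (monom_bracket \<beta> A B) M"
  have f: "?f F G p = - ?f G F (prod.swap p)" for p
    by (cases p) (use mb[of "fst p" "snd p"] in \<open>simp add: mult.commute\<close>)
  have "Sum_any (?f F G) = Sum_any (\<lambda>p. - ?f G F (prod.swap p))"
    by (simp only: f[abs_def])
  also have "\<dots> = Sum_any (\<lambda>p. - ?f G F p)"
    by (rule Sum_any.reindex_cong[of prod.swap, symmetric]) (auto simp: comp_def)
  also have "\<dots> = - Sum_any (?f G F)"
    unfolding Sum_any.expand_set by (simp add: sum_negf)
  finally show "coeff (bracket \<beta> F G) M = coeff (- bracket \<beta> G F) M"
    by (simp add: bracket_def formal_sum_def case_prod_unfold)
qed


section \<open>The generators and their brackets\<close>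

text \<open>
  The generators are indexed by even integers: \<open>T k\<close> and \<open>H k\<close> stand for the variables with
  index \<open>2 k\<close>.  The notations \<open>t n\<close> and \<open>h n\<close> are used for even \<open>n\<close> only.
\<close>

datatype gen = T int | H int

definition t :: "int \<Rightarrow> gen formal" where "t n = var (T (n div 2))"
definition h :: "int \<Rightarrow> gen formal" where "h n = var (H (n div 2))"

text \<open>The parameter \<open>lnq\<close> is the chosen value of the logarithm of \<open>q\<close>.\<close>

definition c :: "complex \<Rightarrow> complex \<Rightarrow> int \<Rightarrow> complex" where
  "c q lnq l = - 2 * lnq * ((q powi l - q powi (-l)) / (q powi l + q powi (-l)))"

fun gen_bracket :: "complex \<Rightarrow> complex \<Rightarrow> gen \<Rightarrow> gen \<Rightarrow> gen formal" where
  "gen_bracket q lnq (T a) (T b) = formal_sum (\<lambda>l. c q lnq l *\<^sub>f (t (2*a - 2*l) * t (2*b + 2*l)))"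
| "gen_bracket q lnq (H a) (T b) = - formal_sum (\<lambda>l. c q lnq l *\<^sub>f (h (2*a - 2*l) * t (2*b + 2*l)))"
| "gen_bracket q lnq (T a) (H b) = formal_sum (\<lambda>l. c q lnq l *\<^sub>f (h (2*b - 2*l) * t (2*a + 2*l)))"
| "gen_bracket q lnq (H a) (H b) = formal_sum (\<lambda>l. c q lnq l *\<^sub>f (h (2*a - 2*l) * h (2*b + 2*l)))"

abbreviation poisson :: "complex \<Rightarrow> complex \<Rightarrow> gen formal \<Rightarrow> gen formal \<Rightarrow> gen formal" where
  "poisson q lnq \<equiv> bracket (gen_bracket q lnq)"

definition s :: "complex \<Rightarrow> int \<Rightarrow> gen formal" where
  "s q n = q powi (- (n div 2)) *\<^sub>f t n + q powi (n div 2) *\<^sub>f h n"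

definition central_sum :: "int \<Rightarrow> gen formal" where
  "central_sum N = formal_sum (\<lambda>l. h (N - 2*l) * t (2*l))"

text \<open>
  Setting the central quantities equal to the numbers \<open>\<xi> N\<close> means passing to cosets of the linear
  span of the relations.  The ideal generated by the relations in the ring of all formal sums
  would not do: a relation with \<open>\<xi> N \<noteq> 0\<close> has nonzero constant term, so it is a unit there and
  every two formal sums would be identified.  Any identification of formal sums that respects
  linear combinations and identifies the central quantities with the numbers \<open>\<xi> N\<close> also
  identifies the elements of each coset of this span.
\<close>

definition central_relations :: "complex \<Rightarrow> (int \<Rightarrow> complex) \<Rightarrow> gen formal set" where
  "central_relations lnq \<xi> = {(- 2 * lnq) *\<^sub>f central_sum N - \<xi> N *\<^sub>f 1 | N. even N}"

definition equal_after_setting ::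
    "complex \<Rightarrow> (int \<Rightarrow> complex) \<Rightarrow> gen formal \<Rightarrow> gen formal \<Rightarrow> bool" where
  "equal_after_setting lnq \<xi> F G \<longleftrightarrow> F - G \<in> formal.span (central_relations lnq \<xi>)"


section \<open>All sums and brackets involved are well defined\<close>

lemma poisson_generators:
  assumes "even n" "even m"
  shows "poisson q lnq (t n) (t m) = formal_sum (\<lambda>l. c q lnq l *\<^sub>f (t (n - 2*l) * t (m + 2*l)))"
    and "poisson q lnq (h n) (t m) = - formal_sum (\<lambda>l. c q lnq l *\<^sub>f (h (n - 2*l) * t (m + 2*l)))"
    and "poisson q lnq (h n) (h m) = formal_sum (\<lambda>l. c q lnq l *\<^sub>f (h (n - 2*l) * h (m + 2*l)))"
  using assms by (simp_all add: t_def[of n] t_def[of m] h_def[of n] h_def[of m] bracket_var)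

lemma formal_summable_var_times_var:
  assumes "inj X"
  shows "formal_summable (\<lambda>l. a l *\<^sub>f (var (X l) * var (Y l)))"
  unfolding formal_summable_def
proof
  fix M
  have "{l. coeff (a l *\<^sub>f (var (X l) * var (Y l))) M \<noteq> 0} \<subseteq> X -` set_mset M"
    by (auto simp: monom_times_monom coeff_monom split: if_splits)
  thus "finite {l. coeff (a l *\<^sub>f (var (X l) * var (Y l))) M \<noteq> 0}"
    by (rule finite_subset) (simp add: finite_vimageI assms)
qed

lemma formal_summable_add:
  assumes "formal_summable F" "formal_summable G"
  shows "formal_summable (\<lambda>i. F i + G i)"
  unfolding formal_summable_def
proof
  fix M
  show "finite {i. coeff (F i + G i) M \<noteq> 0}"
    by (rule finite_subset[of _ "{i. coeff (F i) M \<noteq> 0} \<union> {i. coeff (G i) M \<noteq> 0}"])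
       (use assms in \<open>auto simp: formal_summable_def\<close>)
qed

lemma inj_shift:
  "inj (\<lambda>l. T ((n - 2*l) div 2))" "inj (\<lambda>l. H ((n - 2*l) div 2))"
  by (auto simp: inj_def)

lemma formal_summable_generators:
  "formal_summable (\<lambda>l. a l *\<^sub>f (t (n - 2*l) * t (m + 2*l)))"
  "formal_summable (\<lambda>l. a l *\<^sub>f (t (n - 2*l) * h (m + 2*l)))"
  "formal_summable (\<lambda>l. a l *\<^sub>f (h (n - 2*l) * t (m + 2*l)))"
  "formal_summable (\<lambda>l. a l *\<^sub>f (h (n - 2*l) * h (m + 2*l)))"
  "formal_summable (\<lambda>l. h (n - 2*l) * t (2*l))"
  using formal_summable_var_times_var[OF inj_shift(1), of a n]
    formal_summable_var_times_var[OF inj_shift(2), of a n]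
    formal_summable_var_times_var[OF inj_shift(2), of "\<lambda>_. 1" n]
  by (simp_all only: t_def h_def formal.scale_one)

lemma formal_summable_s:
  "formal_summable (\<lambda>l. a l *\<^sub>f (s q (n - 2*l) * s q (m + 2*l)))"
proof -
  have st: "(x *\<^sub>f F) * (y *\<^sub>f G) = (x * y) *\<^sub>f (F * G)" for x y and F G :: "gen formal"
    by (rule formal_eqI)
       (simp add: coeff_times sum_distrib_left case_prod_unfold mult_ac)
  show ?thesis
    unfolding s_def distrib_left distrib_right st formal.scale_right_distrib formal.scale_scale
    by (intro formal_summable_add formal_summable_generators)
qed

lemma gen_bracket_antisym: "gen_bracket q lnq x y = - gen_bracket q lnq y x"
proof -
  have c_neg: "c q lnq (-l) = - c q lnq l" for l
    by (simp add: c_def add.commute minus_divide_left algebra_simps)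
  have *: "formal_sum (\<lambda>l. c q lnq l *\<^sub>f (g (2*a - 2*l) * g (2*b + 2*l))) =
        - formal_sum (\<lambda>l. c q lnq l *\<^sub>f (g (2*b - 2*l) * g (2*a + 2*l)))"
    for g :: "int \<Rightarrow> gen formal" and a b
  proof (rule formal_eqI)
    fix M
    let ?f = "\<lambda>a b l. coeff (c q lnq l *\<^sub>f (g (2*a - 2*l) * g (2*b + 2*l))) M"
    have f: "?f a b = (\<lambda>l. - ?f b a (- l))"
      by (simp add: fun_eq_iff c_neg mult.commute)
    have "Sum_any (?f a b) = Sum_any (\<lambda>l. - ?f b a (- l))"
      by (rule arg_cong[OF f])
    also have "\<dots> = Sum_any (\<lambda>l. - ?f b a l)"
      by (rule Sum_any.reindex_cong[of uminus, symmetric])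
         (auto simp: comp_def intro: bij_uminus)
    also have "\<dots> = - Sum_any (?f b a)"
      unfolding Sum_any.expand_set by (simp add: sum_negf)
    finally show "coeff (formal_sum (\<lambda>l. c q lnq l *\<^sub>f (g (2*a - 2*l) * g (2*b + 2*l)))) M =
        coeff (- formal_sum (\<lambda>l. c q lnq l *\<^sub>f (g (2*b - 2*l) * g (2*a + 2*l)))) M"
      by (simp add: formal_sum_def)
  qed
  show ?thesis
    by (cases x; cases y; simp only: gen_bracket.simps minus_minus)
       (rule *[of t] *[of h])+
qed

lemma poisson_defined_s: "bracket_defined \<beta> (s q n) (s q m)"
proof -
  have "finite {A. coeff (s q k) A \<noteq> 0}" for k
    by (rule finite_subset[of _ "{{#T (k div 2)#}, {#H (k div 2)#}}"])
       (auto simp: s_def t_def h_def coeff_monom split: if_splits)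
  thus ?thesis by (intro bracket_defined_finite_support)
qed

lemma coeff_central_sum_nz:
  assumes "coeff (central_sum N) B \<noteq> 0"
  shows "\<exists>l. B = {#H ((N - 2*l) div 2), T l#}"
proof (rule ccontr)
  assume "\<nexists>l. B = {#H ((N - 2*l) div 2), T l#}"
  hence "coeff (h (N - 2*l) * t (2*l)) B = 0" for l
    by (simp add: h_def t_def monom_times_monom coeff_monom add_mset_commute)
  thus False using assms by (simp add: central_sum_def formal_sum_def)
qed

lemma poisson_defined_central_sum: "bracket_defined \<beta> (var x) (central_sum N)"
  unfolding bracket_defined_def formal_summable_def
proof
  fix M
  let ?B = "\<lambda>l. {#H ((N - 2*l) div 2), T l#}"
  let ?L = "T -` set_mset M \<union> (\<lambda>l. H ((N - 2*l) div 2)) -` set_mset M"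
  have "{p. coeff (case p of (A, B) \<Rightarrow>
            (coeff (var x) A * coeff (central_sum N) B) *\<^sub>f monom_bracket \<beta> A B) M \<noteq> 0}
        \<subseteq> (\<lambda>l. ({#x#}, ?B l)) ` ?L"
  proof clarify
    fix A B
    assume "coeff ((coeff (var x) A * coeff (central_sum N) B) *\<^sub>f monom_bracket \<beta> A B) M \<noteq> 0"
    hence A: "A = {#x#}" and "coeff (central_sum N) B \<noteq> 0"
      and nz: "coeff (monom_bracket \<beta> A B) M \<noteq> 0"
      by (auto simp: coeff_monom split: if_splits)
    then obtain l where B: "B = ?B l" using coeff_central_sum_nz by blast
    have "coeff (monom {#T l#} * \<beta> x (H ((N - 2*l) div 2))) M \<noteq> 0 \<or>
          coeff (monom {#H ((N - 2*l) div 2)#} * \<beta> x (T l)) M \<noteq> 0"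
      using nz by (auto simp: A B monom_bracket_def monom_empty)
    hence "l \<in> ?L" by (auto dest!: coeff_monom_times_nz)
    thus "(A, B) \<in> (\<lambda>l. ({#x#}, ?B l)) ` ?L" using A B by blast
  qed
  moreover have "finite ?L"
    by (simp add: finite_vimageI inj_shift(2) inj_def[of T])
  ultimately show "finite {p. coeff (case p of (A, B) \<Rightarrow>
            (coeff (var x) A * coeff (central_sum N) B) *\<^sub>f monom_bracket \<beta> A B) M \<noteq> 0}"
    by (rule finite_subset[OF _ finite_imageI])
qed

end

theory Submission
  imports Defs
begin

text \<open>
  The identity for \<open>{s, s}\<close> is a comparison of the mixed terms \<open>h t\<close>: they are collected by the index
  of the factor \<open>t\<close>, and \<open>(q\<^sup>l - q\<^sup>-\<^sup>l) / (q\<^sup>l + q\<^sup>-\<^sup>l) \<cdot> (1 + q\<^sup>-\<^sup>2\<^sup>l) = 1 - q\<^sup>-\<^sup>2\<^sup>l\<close> makes the surplus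
  coefficient independent of that index.  For centrality, the Leibniz rule yields two double sums over
  \<open>\<int>\<^sup>2\<close> that are negatives of each other after the unimodular substitution \<open>(p, l) \<mapsto> (p + l, - l)\<close>
  (or \<open>(p + l, l)\<close>); each monomial occurs finitely often in them, so they may be rearranged.
\<close>

section \<open>Formal sums\<close>

lemma coeff_formal_sum [simp]: "coeff (formal_sum F) M = Sum_any (\<lambda>i. coeff (F i) M)"
  by (simp add: formal_sum_def)

lemma formal_sum_add:
  assumes "formal_summable F" "formal_summable G"
  shows "formal_sum (\<lambda>i. F i + G i) = formal_sum F + formal_sum G"
  using assms by (intro formal_eqI) (simp add: formal_summable_def Sum_any.distrib)

lemma formal_sum_scale: "formal_sum (\<lambda>i. a *\<^sub>f F i) = a *\<^sub>f formal_sum F"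
proof (rule formal_eqI)
  fix M
  show "coeff (formal_sum (\<lambda>i. a *\<^sub>f F i)) M = coeff (a *\<^sub>f formal_sum F) M"
    \<comment> \<open>For \<open>a = 0\<close> both sides vanish. For \<open>a \<noteq> 0\<close>
      the supports agree, so even the default value 0 of \<open>Sum_any\<close> on an infinite
      support is the same on both sides.\<close>
    by (cases "a = 0") (simp_all add: Sum_any.expand_set sum_distrib_left)
qed

lemma scale_minus_one: "(-1) *\<^sub>f F = - F"
  by (rule formal_eqI) simp

lemma formal_sum_uminus: "formal_sum (\<lambda>i. - F i) = - formal_sum F"
  using formal_sum_scale[of "-1" F] by (simp only: scale_minus_one)

lemma formal_sum_reindex: "bij f \<Longrightarrow> formal_sum F = formal_sum (\<lambda>i. F (f i))"
  by (rule formal_eqI) (simp only: coeff_formal_sum, rule Sum_any.reindex_cong, simp_all add: comp_def)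

lemma formal_summable_reindex:
  assumes "inj f" "formal_summable F"
  shows "formal_summable (\<lambda>i. F (f i))"
  unfolding formal_summable_def
proof
  fix M
  have "finite {i. coeff (F i) M \<noteq> 0}" using assms(2) by (simp add: formal_summable_def)
  from finite_vimageI[OF this assms(1)] show "finite {i. coeff (F (f i)) M \<noteq> 0}"
    by (simp add: vimage_def)
qed

lemma coeff_monom_times:
  "coeff (monom A * F) M = (if A \<subseteq># M then coeff F (M - A) else 0)"
proof (cases "A \<subseteq># M")
  case True
  have "coeff (monom A * F) M = (\<Sum>(B, C)\<in>{(A, M - A)}. coeff (monom A) B * coeff F C)"
    unfolding coeff_times using True
    by (intro sum.mono_neutral_right finite_splits) (auto simp: coeff_monom split: if_splits)
  with True show ?thesis by (simp add: coeff_monom)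
qed (use coeff_monom_times_nz in auto)

text \<open>Multiplying by a monomial only shifts coefficients: each coefficient of the product is 0
  or a single coefficient of the other factor, so the sum can be pulled out coefficientwise.\<close>

lemma monom_times_formal_sum: "monom A * formal_sum F = formal_sum (\<lambda>i. monom A * F i)"
  by (rule formal_eqI) (simp add: coeff_monom_times)

lemma scale_times_scale: "(a *\<^sub>f F) * (b *\<^sub>f G) = (a * b) *\<^sub>f (F * G)"
  by (rule formal_eqI) (simp add: coeff_times sum_distrib_left case_prod_unfold mult_ac)

lemma times_scale: "F * (b *\<^sub>f G) = b *\<^sub>f (F * G)"
  using scale_times_scale[of 1 F b G] by simp

text \<open>Fubini: at a fixed monomial only finitely many pairs contribute, and they lie in the
  finite rectangle spanned by the two projections of the support.\<close>

lemma formal_sum_iterated: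
  assumes "formal_summable (\<lambda>(i, j). F i j)"
  shows "formal_sum (\<lambda>i. formal_sum (F i)) = formal_sum (\<lambda>(i, j). F i j)"
proof (rule formal_eqI)
  fix M
  let ?S = "{p. coeff (case p of (i, j) \<Rightarrow> F i j) M \<noteq> 0}"
  have "finite ?S" using assms by (simp add: formal_summable_def)
  hence "finite (fst ` ?S \<times> snd ` ?S)" by simp
  moreover have "{i. \<exists>j. coeff (F i j) M \<noteq> 0} \<times> {j. \<exists>i. coeff (F i j) M \<noteq> 0} \<subseteq> fst ` ?S \<times> snd ` ?S"
    by (force simp: image_iff)
  ultimately have "(\<Sum>i. \<Sum>j. coeff (F i j) M) = (\<Sum>(i, j). coeff (F i j) M)"
    by (rule Sum_any.cartesian_product)
  thus "coeff (formal_sum (\<lambda>i. formal_sum (F i))) M = coeff (formal_sum (\<lambda>(i, j). F i j)) M"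
    by (simp add: case_prod_unfold)
qed

text \<open>A fixed monomial contains finitely many variables, hence finitely many pairs of them. If
  a pair of variables of \<open>B i\<close> determines \<open>i\<close>, only finitely many
  \<open>i\<close> can contribute. Two variables are what an index in
  \<open>int \<times> int\<close> requires; for a single integer one variable is repeated.\<close>

lemma formal_summable_monoms:
  assumes "inj f" and "\<And>i. f i \<in> set_mset (B i) \<times> set_mset (B i)"
  shows "formal_summable (\<lambda>i. a i *\<^sub>f monom (B i))"
  unfolding formal_summable_def
proof
  fix M
  have "{i. coeff (a i *\<^sub>f monom (B i)) M \<noteq> 0} \<subseteq> f -` (set_mset M \<times> set_mset M)"
    using assms(2) by (auto simp: coeff_monom split: if_splits)
  thus "finite {i. coeff (a i *\<^sub>f monom (B i)) M \<noteq> 0}"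
    by (rule finite_subset) (simp add: finite_vimageI assms(1))
qed

text \<open>An injection suffices once its range covers the support. This passes from pairs of
  monomials to the summation index of a family.\<close>

lemma Sum_any_inj_reindex:
  assumes "inj f" "\<And>x. g x \<noteq> 0 \<Longrightarrow> x \<in> range f"
  shows "Sum_any g = Sum_any (\<lambda>i. g (f i))"
proof -
  have "{x. g x \<noteq> 0} = f ` {i. g (f i) \<noteq> 0}" using assms(2) by auto
  thus ?thesis
    unfolding Sum_any.expand_set
    using sum.reindex[of f "{i. g (f i) \<noteq> 0}" g] assms(1)
    by (simp add: inj_on_def comp_def)
qed


section \<open>Brackets\<close>

lemma bracket_finite_support:
  assumes "finite S" "\<And>A. coeff F A \<noteq> 0 \<Longrightarrow> A \<in> S"
    and "finite S'" "\<And>B. coeff G B \<noteq> 0 \<Longrightarrow> B \<in> S'"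
  shows "bracket \<beta> F G = (\<Sum>A\<in>S. \<Sum>B\<in>S'. (coeff F A * coeff G B) *\<^sub>f monom_bracket \<beta> A B)"
proof (rule formal_eqI)
  fix M
  have coeff_sum: "coeff (sum f X) M = (\<Sum>x\<in>X. coeff (f x) M)" for f :: "'b \<Rightarrow> 'a formal" and X
    by (induction X rule: infinite_finite_induct) auto
  have "coeff (bracket \<beta> F G) M
      = (\<Sum>p\<in>S \<times> S'. coeff (case p of (A, B) \<Rightarrow> (coeff F A * coeff G B) *\<^sub>f monom_bracket \<beta> A B) M)"
    unfolding bracket_def coeff_formal_sum
    by (rule Sum_any.expand_superset) (use assms in auto)
  thus "coeff (bracket \<beta> F G) M
      = coeff (\<Sum>A\<in>S. \<Sum>B\<in>S'. (coeff F A * coeff G B) *\<^sub>f monom_bracket \<beta> A B) M"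
    by (simp add: coeff_sum sum.cartesian_product case_prod_unfold)
qed

text \<open>Since the monomials \<open>B i\<close> are distinct, the sum has coefficient 1 at each
  of them and 0 elsewhere, so the sum over pairs of monomials becomes a sum over
  \<open>i\<close>.\<close>

lemma bracket_var_sum_monoms:
  assumes "inj B"
  shows "bracket \<beta> (var x) (formal_sum (\<lambda>i. monom (B i)))
    = formal_sum (\<lambda>i. monom_bracket \<beta> {#x#} (B i))"
proof (rule formal_eqI)
  fix M
  let ?G = "formal_sum (\<lambda>i. monom (B i))"
  have G: "coeff ?G (B i) = 1" for i
  proof -
    have "(\<lambda>j. coeff (monom (B j)) (B i)) = (\<lambda>j. if j = i then 1 else 0)"
      using assms by (auto simp: coeff_monom fun_eq_iff inj_def)
    thus ?thesis by (simp del: Sum_any.cong cong del: Sum_any.cong)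
  qed
  have G_range: "C \<in> range B" if nz: "coeff ?G C \<noteq> 0" for C
  proof -
    obtain i where "coeff (monom (B i)) C \<noteq> 0"
      using nz by (auto elim: Sum_any.not_neutral_obtains_not_neutral)
    thus ?thesis by (auto simp: coeff_monom split: if_splits)
  qed
  let ?g = "\<lambda>p. coeff (case p of (A, C) \<Rightarrow>
      (coeff (var x) A * coeff ?G C) *\<^sub>f monom_bracket \<beta> A C) M"
  have "coeff (bracket \<beta> (var x) ?G) M = Sum_any ?g"
    by (simp only: bracket_def coeff_formal_sum)
  also have "\<dots> = Sum_any (\<lambda>i. ?g ({#x#}, B i))"
  proof (rule Sum_any_inj_reindex)
    show "inj (\<lambda>i. ({#x#}, B i))" using assms by (auto simp: inj_def)
    show "p \<in> range (\<lambda>i. ({#x#}, B i))" if "?g p \<noteq> 0" for p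
    proof (cases p)
      case (Pair A C)
      hence "coeff (var x) A \<noteq> 0" "coeff ?G C \<noteq> 0" using that by auto
      thus ?thesis using G_range[of C] Pair by (auto simp: coeff_monom split: if_splits)
    qed
  qed
  also have "\<dots> = coeff (formal_sum (\<lambda>i. monom_bracket \<beta> {#x#} (B i))) M"
    using G by (simp add: coeff_monom)
  finally show "coeff (bracket \<beta> (var x) ?G) M
    = coeff (formal_sum (\<lambda>i. monom_bracket \<beta> {#x#} (B i))) M" .
qed

lemma monom_bracket_var_pair:
  "monom_bracket \<beta> {#x#} {#y, z#} = var z * \<beta> x y + var y * \<beta> x z"
  by (simp add: monom_bracket_def monom_empty)


section \<open>The generators\<close>

lemma t_double: "t (2 * a) = var (T a)" and h_double: "h (2 * a) = var (H a)"
  by (simp_all add: t_def h_def)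

text \<open>Normal form in the halved indices, with every product written as one monomial. The
  defining equations then leave the simp set, so that brackets unfold only to this form.\<close>

lemma gen_bracket_monom:
  "gen_bracket q lnq (T a) (T b) = formal_sum (\<lambda>l. c q lnq l *\<^sub>f monom {#T (a - l), T (b + l)#})"
  "gen_bracket q lnq (H a) (T b) = - formal_sum (\<lambda>l. c q lnq l *\<^sub>f monom {#H (a - l), T (b + l)#})"
  "gen_bracket q lnq (T a) (H b) = formal_sum (\<lambda>l. c q lnq l *\<^sub>f monom {#H (b - l), T (a + l)#})"
  "gen_bracket q lnq (H a) (H b) = formal_sum (\<lambda>l. c q lnq l *\<^sub>f monom {#H (a - l), H (b + l)#})"
  by (simp_all only: gen_bracket.simps t_double h_double monom_times_monom
      flip: right_diff_distrib distrib_left)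
     (simp_all add: add_mset_commute)

declare gen_bracket.simps [simp del]

lemma c_minus: "c q lnq (- l) = - c q lnq l"
  by (simp add: c_def add.commute minus_divide_left algebra_simps)

section \<open>Centrality of the sums of products \<open>h t\<close>\<close>

lemma central_sum_monom: "central_sum (2 * N) = formal_sum (\<lambda>p. monom {#H (N - p), T p#})"
  by (simp only: central_sum_def t_double h_double monom_times_monom flip: right_diff_distrib)
     (simp add: add_mset_commute)

lemma poisson_var_central_sum:
  "poisson q lnq (var x) (central_sum (2 * N))
    = formal_sum (\<lambda>p. var (T p) * gen_bracket q lnq x (H (N - p))
                     + var (H (N - p)) * gen_bracket q lnq x (T p))"
proof -
  have "inj (\<lambda>p. {#H (N - p), T p#})"
    by (auto simp: inj_def add_eq_conv_ex)
  from bracket_var_sum_monoms[OF this] show ?thesis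
    unfolding central_sum_monom by (simp add: monom_bracket_var_pair)
qed

text \<open>\<open>F\<close> and \<open>G\<close> are the families of the two terms of the Leibniz rule.\<close>

lemma formal_sum_iterated_cancel:
  fixes F G :: "'i \<Rightarrow> 'j \<Rightarrow> 'v formal" and f :: "'i \<times> 'j \<Rightarrow> 'i \<times> 'j"
  assumes F: "formal_summable (\<lambda>(i, j). F i j)" and f: "bij f"
    and G: "\<And>i j. G i j = - case_prod F (f (i, j))"
  shows "formal_sum (\<lambda>i. formal_sum (F i) + formal_sum (G i)) = 0"
proof -
  have G': "(\<lambda>(i, j). G i j) = (\<lambda>p. - case_prod F (f p))"
    by (auto simp: G)
  have sG: "formal_summable (\<lambda>(i, j). G i j)"
    using formal_summable_reindex[OF bij_is_inj[OF f] F]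
    by (simp add: G' formal_summable_def)
  \<comment> \<open>Splitting the outer sum requires the inner sums to form summable families. A
    nonzero coefficient of an inner sum comes from a nonzero term, so the outer support lies in a
    projection of a finite set.\<close>
  have outer: "formal_summable (\<lambda>i. formal_sum (K i))" if "formal_summable (\<lambda>(i, j). K i j)"
    for K :: "'i \<Rightarrow> 'j \<Rightarrow> 'v formal"
    unfolding formal_summable_def
  proof
    fix M
    have "{i. coeff (formal_sum (K i)) M \<noteq> 0} \<subseteq> fst ` {p. coeff (case p of (i, j) \<Rightarrow> K i j) M \<noteq> 0}"
    proof
      fix i
      assume "i \<in> {i. coeff (formal_sum (K i)) M \<noteq> 0}"
      then obtain j where "coeff (K i j) M \<noteq> 0"
        by (auto elim: Sum_any.not_neutral_obtains_not_neutral)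
      thus "i \<in> fst ` {p. coeff (case p of (i, j) \<Rightarrow> K i j) M \<noteq> 0}"
        by (intro image_eqI[of _ _ "(i, j)"]) auto
    qed
    thus "finite {i. coeff (formal_sum (K i)) M \<noteq> 0}"
      by (rule finite_subset) (use that in \<open>simp add: formal_summable_def\<close>)
  qed
  have "formal_sum (\<lambda>i. formal_sum (F i) + formal_sum (G i))
      = formal_sum (case_prod F) + formal_sum (\<lambda>(i, j). G i j)"
    using formal_sum_add[OF outer[OF F] outer[OF sG]] formal_sum_iterated[OF F]
      formal_sum_iterated[OF sG] by simp
  also have "formal_sum (\<lambda>(i, j). G i j) = - formal_sum (case_prod F)"
    unfolding G' formal_sum_uminus by (subst formal_sum_reindex[OF f, of "case_prod F"]) simp
  finally show ?thesis by simp
qed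

text \<open>\<open>?F\<close> comes from the bracket with the factor \<open>H\<close>,
  \<open>?G\<close> from the one with the factor \<open>T\<close>. The substitution matches their
  monomials, and the opposite sign comes from \<open>c\<close> being odd.\<close>

lemma poisson_t_central_sum: "poisson q lnq (var (T r)) (central_sum (2 * N)) = 0"
proof -
  let ?F = "\<lambda>p l. c q lnq l *\<^sub>f monom {#T p, H (N - p - l), T (r + l)#}"
  let ?G = "\<lambda>p l. c q lnq l *\<^sub>f monom {#H (N - p), T (r - l), T (p + l)#}"
  have "formal_sum (\<lambda>p. formal_sum (?F p) + formal_sum (?G p)) = 0"
  proof (rule formal_sum_iterated_cancel)
    show "formal_summable (\<lambda>(p, l). ?F p l)"
      using formal_summable_monoms[of "\<lambda>(p, l). (T p, T (r + l))"
          "\<lambda>(p, l). {#T p, H (N - p - l), T (r + l)#}" "\<lambda>(p, l). c q lnq l"]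
      by (auto simp: case_prod_unfold inj_def)
    show "bij (\<lambda>(p, l). (p + l, - l :: int))"
      \<comment> \<open>The substitution is an involution.\<close>
      by (rule o_bij[of "\<lambda>(p, l). (p + l, - l)"]) auto
    show "?G p l = - case_prod ?F (case (p, l) of (p, l) \<Rightarrow> (p + l, - l))" for p l
      by (simp add: c_minus add_mset_commute)
  qed
  thus ?thesis
    by (simp add: poisson_var_central_sum gen_bracket_monom monom_times_formal_sum times_scale
        monom_times_monom add_mset_commute)
qed

text \<open>Here \<open>l\<close> keeps its sign under the substitution; the cancellation comes from
  the minus sign in the bracket of \<open>H\<close> with \<open>T\<close>.\<close>

lemma poisson_h_central_sum: "poisson q lnq (var (H r)) (central_sum (2 * N)) = 0"
proof -
  let ?F = "\<lambda>p l. c q lnq l *\<^sub>f monom {#T p, H (r - l), H (N - p + l)#}"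
  let ?G = "\<lambda>p l. - (c q lnq l *\<^sub>f monom {#H (N - p), H (r - l), T (p + l)#})"
  have "formal_sum (\<lambda>p. formal_sum (?F p) + formal_sum (?G p)) = 0"
  proof (rule formal_sum_iterated_cancel)
    show "formal_summable (\<lambda>(p, l). ?F p l)"
      using formal_summable_monoms[of "\<lambda>(p, l). (T p, H (r - l))"
          "\<lambda>(p, l). {#T p, H (r - l), H (N - p + l)#}" "\<lambda>(p, l). c q lnq l"]
      by (auto simp: case_prod_unfold inj_def)
    show "bij (\<lambda>(p, l). (p + l, l :: int))"
      by (rule o_bij[of "\<lambda>(p, l). (p - l, l)"]) auto
    show "?G p l = - case_prod ?F (case (p, l) of (p, l) \<Rightarrow> (p + l, l))" for p l
      by (simp add: add_mset_commute)
  qed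
  thus ?thesis
    by (simp add: poisson_var_central_sum gen_bracket_monom monom_times_formal_sum times_scale
        monom_times_monom formal_sum_uminus add_mset_commute)
qed

section \<open>Mixed terms, collected by the index of \<open>T\<close>\<close>

text \<open>All mixed terms of total halved index \<open>N\<close> take this form, so comparing them
  reduces to comparing scalar functions of \<open>p\<close>. A constant \<open>g\<close> gives a
  multiple of the central sum.\<close>

definition mixed_sum :: "int \<Rightarrow> (int \<Rightarrow> complex) \<Rightarrow> gen formal" where
  "mixed_sum N g = formal_sum (\<lambda>p. g p *\<^sub>f monom {#H (N - p), T p#})"

lemma summable_mixed: "formal_summable (\<lambda>p. g p *\<^sub>f monom {#H (N - p), T p#})"
  using formal_summable_monoms[of "\<lambda>p. (T p, T p)" "\<lambda>p. {#H (N - p), T p#}" g]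
  by (auto simp: inj_def)

lemma mixed_sum_add: "mixed_sum N (\<lambda>p. f p + g p) = mixed_sum N f + mixed_sum N g"
  unfolding mixed_sum_def formal.scale_left_distrib by (intro formal_sum_add summable_mixed)

lemma mixed_sum_diff: "mixed_sum N (\<lambda>p. f p - g p) = mixed_sum N f - mixed_sum N g"
  using mixed_sum_add[of N "\<lambda>p. f p - g p" g] by simp

lemma mixed_sum_scale: "mixed_sum N (\<lambda>p. a * g p) = a *\<^sub>f mixed_sum N g"
  unfolding mixed_sum_def formal_sum_scale[symmetric] by simp

text \<open>The index of the factor \<open>T\<close> is \<open>p = b + l\<close>; in the companion
  statement for \<open>T H\<close> it is \<open>p = a - l\<close>.\<close>

lemma mixed_sum_HT:
  "formal_sum (\<lambda>l. g l *\<^sub>f monom {#H (a - l), T (b + l)#}) = mixed_sum (a + b) (\<lambda>p. g (p - b))"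
proof -
  have "bij (\<lambda>l. b + l :: int)" by (rule o_bij[of "\<lambda>p. p - b"]) auto
  from formal_sum_reindex[OF this, of "\<lambda>p. g (p - b) *\<^sub>f monom {#H (a + b - p), T p#}"]
  show ?thesis by (simp add: mixed_sum_def)
qed

lemma mixed_sum_TH:
  "formal_sum (\<lambda>l. g l *\<^sub>f monom {#T (a - l), H (b + l)#}) = mixed_sum (a + b) (\<lambda>p. g (a - p))"
proof -
  have "bij (\<lambda>l. a - l :: int)" by (rule o_bij[of "\<lambda>p. a - p"]) auto
  from formal_sum_reindex[OF this, of "\<lambda>p. g (a - p) *\<^sub>f monom {#H (a + b - p), T p#}"]
  show ?thesis by (simp add: mixed_sum_def add_mset_commute add.commute)
qed

lemma central_sum_mixed: "central_sum (2 * N) = mixed_sum N (\<lambda>_. 1)"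
  by (simp add: central_sum_monom mixed_sum_def)

section \<open>Brackets and products of the \<open>s\<close> in terms of generators\<close>

lemma s_double: "s q (2 * a) = q powi (- a) *\<^sub>f var (T a) + q powi a *\<^sub>f var (H a)"
  by (simp add: s_def t_double h_double)

text \<open>The \<open>T T\<close> and \<open>H H\<close> parts carry powers of \<open>q\<close>
  independent of \<open>l\<close>, the same as in the sum of products of \<open>s\<close>. Only the
  mixed part can differ.\<close>

lemma poisson_s:
  assumes "q \<noteq> 0"
  shows "poisson q lnq (s q (2 * a)) (s q (2 * b))
    = q powi (- a - b) *\<^sub>f formal_sum (\<lambda>l. c q lnq l *\<^sub>f monom {#T (a - l), T (b + l)#})
    + q powi (a + b) *\<^sub>f formal_sum (\<lambda>l. c q lnq l *\<^sub>f monom {#H (a - l), H (b + l)#})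
    + mixed_sum (a + b) (\<lambda>p. q powi (b - a) * c q lnq (p - a) - q powi (a - b) * c q lnq (p - b))"
proof -
  have s_T: "coeff (s q (2 * k)) {#T k#} = q powi (- k)"
    and s_H: "coeff (s q (2 * k)) {#H k#} = q powi k" for k
    by (simp_all add: s_double coeff_monom)
  have s_nz: "A \<in> {{#T k#}, {#H k#}}" if "coeff (s q (2 * k)) A \<noteq> 0" for k A
    using that by (auto simp: s_double coeff_monom split: if_splits)
  have "poisson q lnq (s q (2 * a)) (s q (2 * b))
      = (q powi (- a) * q powi (- b)) *\<^sub>f gen_bracket q lnq (T a) (T b)
      + (q powi (- a) * q powi b) *\<^sub>f gen_bracket q lnq (T a) (H b)
      + (q powi a * q powi (- b)) *\<^sub>f gen_bracket q lnq (H a) (T b)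
      + (q powi a * q powi b) *\<^sub>f gen_bracket q lnq (H a) (H b)"
    by (subst bracket_finite_support[OF _ s_nz _ s_nz])
       (simp_all add: monom_bracket_var, simp only: s_T s_H add.assoc)
  also have "q powi (- a) * q powi (- b) = q powi (- a - b)"
    using assms by (simp flip: power_int_add)
  also have "q powi (- a) * q powi b = q powi (b - a)"
    using assms by (simp flip: power_int_add)
  also have "q powi a * q powi (- b) = q powi (a - b)"
    using assms by (simp flip: power_int_add)
  also have "q powi a * q powi b = q powi (a + b)"
    using assms by (simp flip: power_int_add)
  also have "gen_bracket q lnq (T a) (H b) = mixed_sum (a + b) (\<lambda>p. c q lnq (p - a))"
    by (simp add: gen_bracket_monom mixed_sum_HT add.commute[of b a])
  also have "gen_bracket q lnq (H a) (T b) = - mixed_sum (a + b) (\<lambda>p. c q lnq (p - b))"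
    by (simp add: gen_bracket_monom mixed_sum_HT)
  finally show ?thesis
    by (simp add: mixed_sum_diff mixed_sum_scale gen_bracket_monom add_ac)
qed

text \<open>The factors of the two mixed families are \<open>q powi (a - b - 2 * l)\<close> and
  \<open>q powi (b - a + 2 * l)\<close>. With \<open>p = b + l\<close> in the first and
  \<open>p = a - l\<close> in the second, both equal \<open>q powi (a + b - 2 * p)\<close>, so the
  coefficients simply add.\<close>

lemma formal_sum_s_times_s:
  assumes "q \<noteq> 0"
  shows "formal_sum (\<lambda>l. g l *\<^sub>f (s q (2 * a - 2 * l) * s q (2 * b + 2 * l)))
    = q powi (- a - b) *\<^sub>f formal_sum (\<lambda>l. g l *\<^sub>f monom {#T (a - l), T (b + l)#})
    + q powi (a + b) *\<^sub>f formal_sum (\<lambda>l. g l *\<^sub>f monom {#H (a - l), H (b + l)#})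
    + mixed_sum (a + b) (\<lambda>p. (g (p - b) + g (a - p)) * q powi (a + b - 2 * p))"
proof -
  let ?TT = "\<lambda>l. (q powi (- a - b) * g l) *\<^sub>f monom {#T (a - l), T (b + l)#}"
  let ?HH = "\<lambda>l. (q powi (a + b) * g l) *\<^sub>f monom {#H (a - l), H (b + l)#}"
  let ?HT = "\<lambda>l. (q powi (a - b - 2 * l) * g l) *\<^sub>f monom {#H (a - l), T (b + l)#}"
  let ?TH = "\<lambda>l. (q powi (b - a + 2 * l) * g l) *\<^sub>f monom {#T (a - l), H (b + l)#}"
  have pw: "q powi i * q powi j = q powi (i + j)" for i j
    using assms by (simp add: power_int_add)
  have summand: "g l *\<^sub>f (s q (2 * a - 2 * l) * s q (2 * b + 2 * l))
      = (?TT l + ?HH l) + (?HT l + ?TH l)" for l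
  proof -
    have "s q (2 * a - 2 * l) * s q (2 * b + 2 * l) = s q (2 * (a - l)) * s q (2 * (b + l))"
      by (simp only: right_diff_distrib distrib_left)
    also have "\<dots> = q powi (- a - b) *\<^sub>f monom {#T (a - l), T (b + l)#}
        + q powi (a + b) *\<^sub>f monom {#H (a - l), H (b + l)#}
        + q powi (a - b - 2 * l) *\<^sub>f monom {#H (a - l), T (b + l)#}
        + q powi (b - a + 2 * l) *\<^sub>f monom {#T (a - l), H (b + l)#}"
      unfolding s_double distrib_left[of "_ *\<^sub>f _"] distrib_right[of "_ *\<^sub>f _"]
        scale_times_scale monom_times_monom pw
      by (simp add: add_mset_commute algebra_simps)
    finally show ?thesis
      by (simp add: formal.scale_right_distrib mult.commute add.assoc)
  qed
  have summable: "formal_summable ?TT" "formal_summable ?HH" "formal_summable ?HT" "formal_summable ?TH"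
    by (rule formal_summable_monoms[of "\<lambda>l. (T (a - l), T (a - l))"]
          formal_summable_monoms[of "\<lambda>l. (H (a - l), H (a - l))"]; auto simp: inj_def)+
  have "formal_sum (\<lambda>l. g l *\<^sub>f (s q (2 * a - 2 * l) * s q (2 * b + 2 * l)))
      = (formal_sum ?TT + formal_sum ?HH) + (formal_sum ?HT + formal_sum ?TH)"
    unfolding summand using summable by (simp add: formal_sum_add formal_summable_add)
  also have "formal_sum ?TT
      = q powi (- a - b) *\<^sub>f formal_sum (\<lambda>l. g l *\<^sub>f monom {#T (a - l), T (b + l)#})"
    by (simp flip: formal_sum_scale)
  also have "formal_sum ?HH
      = q powi (a + b) *\<^sub>f formal_sum (\<lambda>l. g l *\<^sub>f monom {#H (a - l), H (b + l)#})"
    by (simp flip: formal_sum_scale)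
  also have "formal_sum ?HT + formal_sum ?TH
      = mixed_sum (a + b) (\<lambda>p. (g (p - b) + g (a - p)) * q powi (a + b - 2 * p))"
    unfolding mixed_sum_HT mixed_sum_TH mixed_sum_add[symmetric]
    by (rule arg_cong[of _ _ "mixed_sum _"]) (auto simp: algebra_simps)
  finally show ?thesis .
qed

section \<open>The scalar identity behind the central term\<close>

lemma powi_add_powi_minus_nonzero:
  fixes q :: complex
  assumes "0 < cmod q" "cmod q < 1"
  shows "q powi l + q powi (- l) \<noteq> 0"
proof
  assume "q powi l + q powi (- l) = 0"
  hence "q powi l * q powi l = - (q powi (- l) * q powi l)"
    by (simp add: eq_neg_iff_add_eq_0 flip: distrib_right)
  hence "q powi (2 * l) = -1"
    using assms by (auto simp flip: power_int_add)
  moreover from this have "cmod q powi (2 * l) = 1"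
    by (simp flip: norm_power_int)
  \<comment> \<open>Powers of a modulus strictly between 0 and 1 are strictly decreasing, so only
    exponent 0 gives 1; but then \<open>q powi (2 * l)\<close> is 1, not -1.\<close>
  hence "l = 0"
    using power_int_strict_decreasing[of 0 "2 * l" "cmod q"]
      power_int_strict_decreasing[of "2 * l" 0 "cmod q"] assms
    by (cases l "0 :: int" rule: linorder_cases) auto
  ultimately show False by simp
qed

text \<open>Dividing numerator and denominator of \<open>c\<close> by \<open>q powi l\<close> turns
  the denominator into \<open>1 + q powi (- 2 * l)\<close>, which cancels.\<close>

lemma c_times:
  assumes "0 < cmod q" "cmod q < 1"
  shows "c q lnq l * (1 + q powi (- 2 * l)) = - 2 * lnq * (1 - q powi (- 2 * l))"
proof -
  have "q \<noteq> 0" using assms by auto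
  hence "q powi (- 2 * l) = q powi (- l) * q powi (- l)" and "q powi l * q powi (- l) = 1"
    by (simp_all flip: power_int_add)
  thus ?thesis
    using powi_add_powi_minus_nonzero[OF assms, of l]
    unfolding c_def by (simp add: field_simps)
qed

lemma poisson_s_mixed_coeff:
  assumes "0 < cmod q" "cmod q < 1"
  shows "q powi (b - a) * c q lnq (p - a) - q powi (a - b) * c q lnq (p - b)
    = (c q lnq (p - b) + c q lnq (a - p)) * q powi (a + b - 2 * p)
      + (- 2 * lnq) * (q powi (b - a) - q powi (a - b))"
proof -
  have "q \<noteq> 0" using assms by auto
  \<comment> \<open>This is \<open>c_times\<close> at \<open>p - y\<close>, multiplied by
    \<open>q powi (x - y)\<close>. Its last power is symmetric in \<open>x\<close> and
    \<open>y\<close>: subtracting the instance \<open>(a, b)\<close> from \<open>(b, a)\<close>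
    cancels it on the right, leaving a surplus independent of \<open>p\<close>.\<close>
  have *: "c q lnq (p - y) * (q powi (x - y) + q powi (x + y - 2 * p))
      = - 2 * lnq * (q powi (x - y) - q powi (x + y - 2 * p))" for x y
  proof -
    have "q powi (x + y - 2 * p) = q powi (x - y) * q powi (- 2 * (p - y))"
      using \<open>q \<noteq> 0\<close> by (simp add: algebra_simps flip: power_int_add)
    thus ?thesis using c_times[OF assms, of lnq "p - y"] by algebra
  qed
  have "c q lnq (a - p) = - c q lnq (p - a)"
    using c_minus[of q lnq "p - a"] by simp
  thus ?thesis
    using *[of b a] *[of a b] by (simp add: algebra_simps)
qed

section \<open>The bracket of the \<open>s\<close>, centrality, and passage to cosets\<close>

theorem mainTheorem3:
  fixes q lnq :: complex
  assumes "0 < cmod q" and "cmod q < 1" and "exp lnq = q"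
  shows
    "(\<forall>n m. even n \<longrightarrow> even m \<longrightarrow>
        poisson q lnq (s q n) (s q m) =
          (- 2 * lnq) *\<^sub>f
            (formal_sum (\<lambda>l::int.
                ((q powi l - q powi (- l)) / (q powi l + q powi (- l))) *\<^sub>f
                  (s q (n - 2 * l) * s q (m + 2 * l)))
             + (q powi ((m - n) div 2) - q powi ((n - m) div 2)) *\<^sub>f
                 central_sum (n + m))) \<and>
     (\<forall>r n m. even r \<longrightarrow> even n \<longrightarrow> even m \<longrightarrow>
        poisson q lnq (t r) (central_sum (n + m)) = 0 \<and>
        poisson q lnq (h r) (central_sum (n + m)) = 0) \<and>
     (\<forall>\<xi> :: int \<Rightarrow> complex. \<forall>n m. even n \<longrightarrow> even m \<longrightarrow>
        equal_after_setting lnq \<xi>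
          (poisson q lnq (s q n) (s q m))
          ((- 2 * lnq) *\<^sub>f
             formal_sum (\<lambda>l::int.
                ((q powi l - q powi (- l)) / (q powi l + q powi (- l))) *\<^sub>f
                  (s q (n - 2 * l) * s q (m + 2 * l)))
           + (\<xi> (n + m) * (q powi ((m - n) div 2) - q powi ((n - m) div 2))) *\<^sub>f 1))"
proof (intro conjI allI impI)
  let ?ss = "\<lambda>n m. formal_sum (\<lambda>l::int.
    ((q powi l - q powi (- l)) / (q powi l + q powi (- l))) *\<^sub>f (s q (n - 2 * l) * s q (m + 2 * l)))"
  have "q \<noteq> 0" using assms(1) by auto
  show bracket_s: "poisson q lnq (s q n) (s q m) = (- 2 * lnq) *\<^sub>f
      (?ss n m + (q powi ((m - n) div 2) - q powi ((n - m) div 2)) *\<^sub>f central_sum (n + m))"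
    if even: "even n" "even m" for n m
  proof -
    obtain a b where n: "n = 2 * a" and m: "m = 2 * b" using even by (elim evenE)
    have div: "(m - n) div 2 = b - a" "(n - m) div 2 = a - b" "n + m = 2 * (a + b)"
      by (auto simp: n m)
    have "(- 2 * lnq) *\<^sub>f ?ss n m
        = formal_sum (\<lambda>l. c q lnq l *\<^sub>f (s q (2 * a - 2 * l) * s q (2 * b + 2 * l)))"
      by (simp only: formal_sum_scale[symmetric] formal.scale_scale c_def n m)
    moreover have "(- 2 * lnq) *\<^sub>f ((q powi (b - a) - q powi (a - b)) *\<^sub>f central_sum (n + m))
        = mixed_sum (a + b) (\<lambda>_. (- 2 * lnq) * (q powi (b - a) - q powi (a - b)))"
      using mixed_sum_scale[of "a + b" "(- 2 * lnq) * (q powi (b - a) - q powi (a - b))" "\<lambda>_. 1"]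
      by (simp only: div central_sum_mixed formal.scale_scale mult_1_right)
    ultimately show ?thesis
      unfolding div formal.scale_right_distrib
      by (simp only: n m poisson_s[OF \<open>q \<noteq> 0\<close>] formal_sum_s_times_s[OF \<open>q \<noteq> 0\<close>]
          poisson_s_mixed_coeff[OF assms(1,2)] mixed_sum_add add.assoc)
  qed
  show "poisson q lnq (t r) (central_sum (n + m)) = 0"
    and "poisson q lnq (h r) (central_sum (n + m)) = 0"
    if even: "even n" "even m" for r n m
  proof -
    obtain N where "n + m = 2 * N" using even by (metis even_add evenE)
    thus "poisson q lnq (t r) (central_sum (n + m)) = 0"
      and "poisson q lnq (h r) (central_sum (n + m)) = 0"
      by (simp_all only: t_def h_def poisson_t_central_sum poisson_h_central_sum)
  qed
  show "equal_after_setting lnq \<xi> (poisson q lnq (s q n) (s q m))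
      ((- 2 * lnq) *\<^sub>f ?ss n m + (\<xi> (n + m) * (q powi ((m - n) div 2) - q powi ((n - m) div 2))) *\<^sub>f 1)"
    if even: "even n" "even m" for \<xi> n m
  proof -
    let ?k = "q powi ((m - n) div 2) - q powi ((n - m) div 2)"
    have "(- 2 * lnq) *\<^sub>f central_sum (n + m) - \<xi> (n + m) *\<^sub>f 1 \<in> central_relations lnq \<xi>"
      unfolding central_relations_def using even by auto
    \<comment> \<open>Scaling the relation of index \<open>n + m\<close> by the factor
      \<open>?k\<close> of the central sum gives exactly the difference of the two sides, so one
      relation suffices for membership in the span.\<close>
    hence "?k *\<^sub>f ((- 2 * lnq) *\<^sub>f central_sum (n + m) - \<xi> (n + m) *\<^sub>f 1)
        \<in> formal.span (central_relations lnq \<xi>)"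
      by (intro formal.span_scale formal.span_base)
    also have "?k *\<^sub>f ((- 2 * lnq) *\<^sub>f central_sum (n + m) - \<xi> (n + m) *\<^sub>f 1)
        = poisson q lnq (s q n) (s q m) - ((- 2 * lnq) *\<^sub>f ?ss n m + (\<xi> (n + m) * ?k) *\<^sub>f 1)"
      unfolding bracket_s[OF even]
      by (rule formal_eqI) (simp add: algebra_simps del: coeff_formal_sum)
    finally show ?thesis by (simp only: equal_after_setting_def)
  qed
qed

end
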